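(* Let $n\ge1$ and let $t$ be an integer with $t\geq \frac{n^3}{2}$, and let $a_n(t):=K_n(t,0,\ldots,0,-t)$. Then \[ (n-1)!\cdot\binom{t+n-1}{\binom{n}{2}}\prod_{i=0}^{n-2}C_i \;\geq\; a_n(t)\;\geq\;\binom{t+n-1}{\binom{n}{2}}\prod_{i=0}^{n-2}C_i . \]
   Context: For $\bm{N}=(N_0,\ldots,N_n)\in\mathbb{Z}^{n+1}$ with $\sum_iN_i=0$, $K_n(\bm{N})$ is the number of integer vectors $(f_{ij})_{0\le i<j\le n}\in\mathbb{Z}_{\ge0}^{\binom{n+1}{2}}$ with $\sum_{j>i} f_{ij}-\sum_{k<i} f_{ki}=N_i$ for all $i$. Here $(t,0,\ldots,0,-t)\in\mathbb{Z}^{n+1}$, and $C_i=\frac{1}{i+1}\binom{2i}{i}$ is the $i$-th Catalan number (so $C_0=1$). *)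

theory Defs
  imports Main
begin

text \<open>Flows: f is a function on pairs (i,j) with 0 \<le> i < j \<le> n, valued in nonnegative
integers (nat), and zero outside this index set (so they correspond bijectively to
integer vectors indexed by the pairs i<j).\<close>

definition flows :: "nat \<Rightarrow> (nat \<Rightarrow> int) \<Rightarrow> (nat \<times> nat \<Rightarrow> nat) set" where
  "flows n N = {f. (\<forall>i j. \<not> (i < j \<and> j \<le> n) \<longrightarrow> f (i, j) = 0) \<and>
     (\<forall>i\<le>n. (\<Sum>j\<in>{i<..n}. int (f (i, j))) - (\<Sum>k<i. int (f (k, i))) = N i)}"

definition K :: "nat \<Rightarrow> (nat \<Rightarrow> int) \<Rightarrow> nat" where
  "K n N = card (flows n N)"

definition catalan :: "nat \<Rightarrow> nat" where
  "catalan i = ((2 * i) choose i) div (i + 1)"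

definition tvec :: "nat \<Rightarrow> int \<Rightarrow> nat \<Rightarrow> int" where
  "tvec n t = (\<lambda>i. if i = 0 then t else if i = n then - t else 0)"

definition a_n :: "nat \<Rightarrow> int \<Rightarrow> nat" where
  "a_n n t = K n (tvec n t)"

end

theory Submission
  imports Defs Complex_Main "HOL-Library.FuncSet"
begin

text \<open>Eliminating the vertices \<open>0, 1, \<dots>\<close> one after the other, with Vandermonde's identity at each of
them, yields the Lidskii expansion: \<open>a\<^sub>n(t)\<close> is the sum over all \<open>s\<^sub>1, \<dots>, s\<^bsub>n-1\<^esub>\<close> of
\<open>(\<Prod>\<^sub>r (r - 1 choose s\<^sub>r)) K\<^bsub>n-1\<^esub>(s\<^sub>1, \<dots>, s\<^bsub>n-1\<^esub>, -\<Sum>s) (t + n - 1 choose n - 1 + \<Sum>s)\<close>.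
The term with all \<open>s\<^sub>r = r - 1\<close> is the lower bound. Since \<open>K\<close> grows with the supplies, replacing every
\<open>K\<close> by the one of that term gives an upper bound that sums to a single binomial coefficient, and
\<open>t \<ge> n\<^sup>3 / 2\<close> makes this at most \<open>(n - 1)!\<close> times the lower bound. The factor
\<open>K\<^bsub>n-1\<^esub>(0, 1, \<dots>, n - 2, -\<Sum>)\<close> is the product of Catalan numbers by the constant term identity of
Morris and Zeilberger. It follows by Aomoto's method: the constant terms weighted by successive
elementary symmetric polynomials satisfy a two-term linear recurrence.\<close>

section \<open>Flows\<close>

lemma flowsD:
  assumes "f \<in> flows n N"
  shows "\<not> (i < j \<and> j \<le> n) \<Longrightarrow> f (i, j) = 0"
    and "i \<le> n \<Longrightarrow> (\<Sum>j\<in>{i<..n}. int (f (i, j))) - (\<Sum>k<i. int (f (k, i))) = N i"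
  using assms by (auto simp: flows_def)

lemma flows_cong:
  assumes "\<And>i. i \<le> n \<Longrightarrow> N i = N' i"
  shows "flows n N = flows n N'"
  using assms by (auto simp: flows_def)

text \<open>The outflow of \<open>i\<close> is \<open>N i\<close> plus an inflow that comes from
  smaller vertices only, so bounds propagate by strong induction along the vertex order.\<close>

lemma flows_bounded: "\<exists>B. \<forall>f\<in>flows n N. \<forall>j. f (i, j) \<le> B"
proof (induction i rule: less_induct)
  case (less i)
  then obtain B where B: "\<And>k f j. k < i \<Longrightarrow> f \<in> flows n N \<Longrightarrow> f (k, j) \<le> B k"
    by metis
  have "f (i, j) \<le> nat (N i + (\<Sum>k<i. int (B k)))" if f: "f \<in> flows n N" for f j
  proof (cases "i < j \<and> j \<le> n")
    case True
    have "int (f (i, j)) \<le> (\<Sum>j\<in>{i<..n}. int (f (i, j)))"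
      using True by (intro member_le_sum) auto
    also have "\<dots> = N i + (\<Sum>k<i. int (f (k, i)))"
      using flowsD(2)[OF f, of i] True by simp
    also have "\<dots> \<le> N i + (\<Sum>k<i. int (B k))"
      using B[OF _ f] by (intro add_left_mono sum_mono) auto
    finally show ?thesis by linarith
  qed (use flowsD(1)[OF f] in auto)
  then show ?case by blast
qed

lemma finite_flows: "finite (flows n N)"
proof -
  obtain B where B: "\<And>i f j. f \<in> flows n N \<Longrightarrow> f (i, j) \<le> B i"
    using flows_bounded by metis
  define M where "M = Max (B ` {..n})"
  have M: "f (i, j) \<le> M" if "f \<in> flows n N" "i < j" "j \<le> n" for f i j
    using B[OF that(1), of i j] that unfolding M_def
    by (meson Max_ge atMost_iff dual_order.trans finite_atMost finite_imageI imageI less_imp_le_nat)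
  have "flows n N \<subseteq> {f. \<forall>p. (p \<in> {..n} \<times> {..n} \<longrightarrow> f p \<in> {..M}) \<and>
      (p \<notin> {..n} \<times> {..n} \<longrightarrow> f p = 0)}"
  proof (intro subsetI CollectI allI)
    fix f and p :: "nat \<times> nat" assume f: "f \<in> flows n N"
    obtain i j where p: "p = (i, j)" by fastforce
    show "(p \<in> {..n} \<times> {..n} \<longrightarrow> f p \<in> {..M}) \<and> (p \<notin> {..n} \<times> {..n} \<longrightarrow> f p = 0)"
      using M[OF f, of i j] flowsD(1)[OF f, of i j]
      by (cases "i < j \<and> j \<le> n") (simp_all add: p)
  qed
  then show ?thesis
    by (rule finite_subset) (intro finite_set_of_finite_funs, auto)
qed

section \<open>Moving one unit along an edge\<close>

abbreviation add_edge :: "nat \<Rightarrow> nat \<Rightarrow> (nat \<times> nat \<Rightarrow> nat) \<Rightarrow> nat \<times> nat \<Rightarrow> nat" where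
  "add_edge i j f \<equiv> f((i, j) := Suc (f (i, j)))"

lemma add_edge_in_flows_iff:
  assumes ij: "i < j" "j \<le> n"
  shows "add_edge i j f \<in> flows n N \<longleftrightarrow> f \<in> flows n (N(i := N i - 1, j := N j + 1))"
proof -
  let ?g = "add_edge i j f" and ?N = "N(i := N i - 1, j := N j + 1)"
  have out: "(\<Sum>b\<in>{a<..n}. int (?g (a, b))) = (\<Sum>b\<in>{a<..n}. int (f (a, b))) + of_bool (a = i)" for a
  proof -
    have "(\<Sum>b\<in>{a<..n}. int (?g (a, b))) =
        (\<Sum>b\<in>{a<..n}. int (f (a, b)) + (if j = b then of_bool (a = i) else 0))"
      by (intro sum.cong) auto
    then show ?thesis using ij by (auto simp: sum.distrib)
  qed
  have inn: "(\<Sum>b<a. int (?g (b, a))) = (\<Sum>b<a. int (f (b, a))) + of_bool (a = j)" for a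
  proof -
    have "(\<Sum>b<a. int (?g (b, a))) =
        (\<Sum>b<a. int (f (b, a)) + (if i = b then of_bool (a = j) else 0))"
      by (intro sum.cong) auto
    then show ?thesis using ij by (auto simp: sum.distrib)
  qed
  have "(\<forall>a b. \<not> (a < b \<and> b \<le> n) \<longrightarrow> ?g (a, b) = 0) \<longleftrightarrow> (\<forall>a b. \<not> (a < b \<and> b \<le> n) \<longrightarrow> f (a, b) = 0)"
    using ij by auto
  moreover have "(\<Sum>b\<in>{a<..n}. int (?g (a, b))) - (\<Sum>b<a. int (?g (b, a))) = N a \<longleftrightarrow>
      (\<Sum>b\<in>{a<..n}. int (f (a, b))) - (\<Sum>b<a. int (f (b, a))) = ?N a" for a
    unfolding out inn using ij by auto
  ultimately show ?thesis
    by (simp only: flows_def mem_Collect_eq)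
qed

text \<open>Taking one unit off an edge that carries flow inverts \<open>add_edge\<close>. On
  generating functions this is multiplication by \<open>x_i / x_j\<close>.\<close>

lemma flows_using_edge:
  assumes ij: "i < j" "j \<le> n"
  shows "{f \<in> flows n N. f (i, j) > 0} = add_edge i j ` flows n (N(i := N i - 1, j := N j + 1))"
proof (intro equalityI subsetI)
  fix f assume f: "f \<in> {f \<in> flows n N. f (i, j) > 0}"
  then have "f = add_edge i j (f((i, j) := f (i, j) - 1))"
    by (auto simp: fun_eq_iff)
  then show "f \<in> add_edge i j ` flows n (N(i := N i - 1, j := N j + 1))"
    using f add_edge_in_flows_iff[OF ij] by (metis (lifting) image_eqI mem_Collect_eq)
qed (use add_edge_in_flows_iff[OF ij] in auto)

lemma inj_add_edge: "inj_on (add_edge i j) A"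
proof (rule inj_onI)
  fix f g assume *: "add_edge i j f = add_edge i j g"
  show "f = g"
  proof
    fix p show "f p = g p"
      using fun_cong[OF *, of p] by (cases "p = (i, j)") auto
  qed
qed

text \<open>Let \<open>F = \<Prod>_(a<b) 1 / (1 - x_a / x_b)\<close> be the generating function of
  \<open>K n\<close>. These are the coefficients of \<open>F z / (1 - z)\<close> with
  \<open>z = x_i / x_j\<close>; \<open>edge_flow_rec\<close> is multiplication by
  \<open>1 - z\<close>.\<close>

definition edge_flow :: "nat \<Rightarrow> (nat \<Rightarrow> int) \<Rightarrow> nat \<Rightarrow> nat \<Rightarrow> int" where
  "edge_flow n N i j = (\<Sum>f\<in>flows n N. int (f (i, j)))"

lemma edge_flow_rec:
  fixes N :: "nat \<Rightarrow> int"
  assumes ij: "i < j" "j \<le> n"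
  defines "N' \<equiv> N(i := N i - 1, j := N j + 1)"
  shows "edge_flow n N i j = int (K n N') + edge_flow n N' i j"
proof -
  have "edge_flow n N i j = (\<Sum>f\<in>{f \<in> flows n N. f (i, j) > 0}. int (f (i, j)))"
    unfolding edge_flow_def by (intro sum.mono_neutral_right) (auto simp: finite_flows)
  also have "\<dots> = (\<Sum>f\<in>flows n N'. 1 + int (f (i, j)))"
    unfolding flows_using_edge[OF ij] N'_def by (subst sum.reindex[OF inj_add_edge]) simp
  finally show ?thesis
    by (simp add: sum.distrib edge_flow_def K_def)
qed

text \<open>The left side counts exactly those flows with netflow \<open>N\<close> that use the
  edge.\<close>

lemma K_edge_mono:
  assumes ij: "i < j" "j \<le> n"
  shows "K n (N(i := N i - 1, j := N j + 1)) \<le> K n N"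
proof -
  have "K n (N(i := N i - 1, j := N j + 1)) = card {f \<in> flows n N. f (i, j) > 0}"
    unfolding flows_using_edge[OF ij] K_def by (subst card_image[OF inj_add_edge]) simp
  also have "\<dots> \<le> K n N"
    unfolding K_def by (intro card_mono finite_flows) auto
  finally show ?thesis .
qed

text \<open>The conservation law at \<open>i\<close> summed over all flows; on generating functions,
  the derivative \<open>x_i \<partial>F / \<partial>x_i\<close>.\<close>

lemma netflow_times_K:
  assumes "i \<le> n"
  shows "N i * int (K n N) = (\<Sum>j\<in>{i<..n}. edge_flow n N i j) - (\<Sum>k<i. edge_flow n N k i)"
proof -
  have "N i * int (K n N) =
      (\<Sum>f\<in>flows n N. (\<Sum>j\<in>{i<..n}. int (f (i, j))) - (\<Sum>k<i. int (f (k, i))))"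
    using flowsD(2)[OF _ assms] by (simp add: K_def)
  also have "\<dots> = (\<Sum>j\<in>{i<..n}. edge_flow n N i j) - (\<Sum>k<i. edge_flow n N k i)"
    unfolding edge_flow_def
    by (simp only: sum_subtractf sum.swap[of _ _ "flows n N"])
  finally show ?thesis .
qed

section \<open>Elimination of the first vertex\<close>

definition comps :: "nat \<Rightarrow> nat \<Rightarrow> (nat \<Rightarrow> nat) set" where
  "comps n T = {y. (\<forall>i>n. y i = 0) \<and> (\<Sum>i\<le>n. y i) = T}"

lemma comps_le: "y \<in> comps n T \<Longrightarrow> y i \<le> T"
  by (cases "i \<le> n") (auto simp: comps_def intro!: member_le_sum)

lemma finite_comps: "finite (comps n T)"
proof (rule finite_subset)
  show "comps n T \<subseteq> {f. \<forall>i. (i \<in> {..n} \<longrightarrow> f i \<in> {..T}) \<and> (i \<notin> {..n} \<longrightarrow> f i = 0)}"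
    using comps_le by (force simp: comps_def)
qed (intro finite_set_of_finite_funs, auto)

text \<open>Vertex 0 has no incoming edge, so its outgoing edges carry an arbitrary composition
  \<open>y\<close> of its supply. What arrives at vertex \<open>i + 1\<close> acts as extra supply
  there, and the remaining vertices are renumbered.\<close>

lemma K_peel:
  assumes "N 0 = int b"
  shows "K (Suc n) N = (\<Sum>y\<in>comps n b. K n (\<lambda>i. N (Suc i) + int (y i)))"
proof -
  let ?M = "\<lambda>y i. N (Suc i) + int (y i)"
  \<comment> \<open>\<open>glue\<close> places \<open>y\<close> on the edges out of 0 and shifts the
    flow \<open>g\<close> by one vertex; pairs ending in 0 get the value 0, since no edge ends
    there.\<close>
  define glue :: "(nat \<Rightarrow> nat) \<times> (nat \<times> nat \<Rightarrow> nat) \<Rightarrow> nat \<times> nat \<Rightarrow> nat" where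
    "glue = (\<lambda>(y, g) (i, j). case j of 0 \<Rightarrow> 0 | Suc j' \<Rightarrow> (case i of 0 \<Rightarrow> y j' | Suc i' \<Rightarrow> g (i', j')))"
  define cut :: "(nat \<times> nat \<Rightarrow> nat) \<Rightarrow> (nat \<Rightarrow> nat) \<times> (nat \<times> nat \<Rightarrow> nat)" where
    "cut = (\<lambda>f. (\<lambda>j. f (0, Suc j), \<lambda>(i, j). f (Suc i, Suc j)))"
  have out: "(\<Sum>j\<in>{Suc i<..Suc n}. h j) = (\<Sum>j\<in>{i<..n}. h (Suc j))" for h :: "nat \<Rightarrow> int" and i
    by (rule sum.reindex_bij_witness[of _ Suc "\<lambda>j. j - 1"]) auto
  have out0: "(\<Sum>j\<in>{0<..Suc n}. h j) = (\<Sum>j\<le>n. h (Suc j))" for h :: "nat \<Rightarrow> int"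
    by (rule sum.reindex_bij_witness[of _ Suc "\<lambda>j. j - 1"]) auto
  have "bij_betw glue (SIGMA y:comps n b. flows n (?M y)) (flows (Suc n) N)"
  proof (rule bij_betw_byWitness[where f' = cut])
    show "\<forall>p\<in>SIGMA y:comps n b. flows n (?M y). cut (glue p) = p"
      by (auto simp: cut_def glue_def)
    show "\<forall>f\<in>flows (Suc n) N. glue (cut f) = f"
    proof
      fix f assume "f \<in> flows (Suc n) N"
      then have "f (i, 0) = 0" for i by (simp add: flows_def)
      then show "glue (cut f) = f"
        by (auto simp: cut_def glue_def fun_eq_iff split: nat.splits)
    qed
    show "glue ` (SIGMA y:comps n b. flows n (?M y)) \<subseteq> flows (Suc n) N"
    proof safe
      fix y g assume y: "y \<in> comps n b" and g: "g \<in> flows n (?M y)"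
      have "glue (y, g) (i, j) = 0" if "\<not> (i < j \<and> j \<le> Suc n)" for i j
        using that y by (cases i; cases j) (auto simp: glue_def comps_def intro!: flowsD(1)[OF g])
      moreover have "(\<Sum>j\<in>{i<..Suc n}. int (glue (y, g) (i, j))) - (\<Sum>k<i. int (glue (y, g) (k, i))) = N i"
        if "i \<le> Suc n" for i
      proof (cases i)
        case 0
        have "(\<Sum>j\<le>n. int (y j)) = int b"
          using y by (auto simp: comps_def simp flip: of_nat_sum)
        then show ?thesis
          using assms unfolding 0 out0 by (simp add: glue_def)
      next
        case (Suc i')
        then show ?thesis
          using flowsD(2)[OF g, of i'] that
          unfolding Suc out sum.lessThan_Suc_shift by (simp add: glue_def)
      qed
      ultimately show "glue (y, g) \<in> flows (Suc n) N"
        by (simp add: flows_def)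
    qed
    show "cut ` flows (Suc n) N \<subseteq> (SIGMA y:comps n b. flows n (?M y))"
    proof safe
      fix f y g assume f: "f \<in> flows (Suc n) N" and c: "(y, g) = cut f"
      have y: "y = (\<lambda>j. f (0, Suc j))" and g: "g = (\<lambda>(i, j). f (Suc i, Suc j))"
        using c by (auto simp: cut_def)
      have "(\<Sum>j\<le>n. int (y j)) = int b"
        using flowsD(2)[OF f, of 0] assms unfolding out0 y by simp
      then have "(\<Sum>j\<le>n. y j) = b"
        by (simp flip: of_nat_sum)
      then show "y \<in> comps n b"
        using flowsD(1)[OF f] by (auto simp: comps_def y)
      have "(\<Sum>j\<in>{i<..n}. int (g (i, j))) - (\<Sum>k<i. int (g (k, i))) = ?M y i" if "i \<le> n" for i
        using flowsD(2)[OF f, of "Suc i"] that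
        unfolding y g out sum.lessThan_Suc_shift by simp
      then show "g \<in> flows n (?M y)"
        using flowsD(1)[OF f] by (auto simp: flows_def g)
    qed
  qed
  then have "K (Suc n) N = card (SIGMA y:comps n b. flows n (?M y))"
    unfolding K_def by (simp add: bij_betw_same_card)
  also have "\<dots> = (\<Sum>y\<in>comps n b. K n (?M y))"
    unfolding K_def by (rule card_SigmaI) (auto simp: finite_comps finite_flows)
  finally show ?thesis .
qed

section \<open>Netflows balanced at the sink\<close>

text \<open>Flows exist only for netflows of total 0, so the entry at the sink is forced. The
  supplies below \<open>n\<close> then vary freely; on generating functions, \<open>x_n\<close> is
  set to 1.\<close>

definition balance :: "nat \<Rightarrow> (nat \<Rightarrow> int) \<Rightarrow> nat \<Rightarrow> int" where
  "balance n N = N(n := - (\<Sum>i<n. N i))"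

definition balanced_K :: "nat \<Rightarrow> (nat \<Rightarrow> int) \<Rightarrow> nat" where
  "balanced_K n N = K n (balance n N)"

lemma K_cong: "(\<And>i. i \<le> n \<Longrightarrow> N i = N' i) \<Longrightarrow> K n N = K n N'"
  unfolding K_def using flows_cong by metis

lemma balanced_K_cong: "(\<And>i. i < n \<Longrightarrow> N i = N' i) \<Longrightarrow> balanced_K n N = balanced_K n N'"
  unfolding balanced_K_def balance_def by (intro K_cong) auto

lemma balanced_K_0: "balanced_K 0 N = 1"
proof -
  have "flows 0 (N(0 := 0)) = {\<lambda>_. 0}"
    by (auto simp: flows_def)
  then show ?thesis by (simp add: balanced_K_def balance_def K_def)
qed

text \<open>Peeling keeps the total 0: the supply \<open>b\<close> of vertex 0 reappears as the
  total of \<open>y\<close>. The share \<open>y n\<close> goes straight to the sink and is absorbed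
  by \<open>balance\<close>.\<close>

lemma balanced_K_peel:
  assumes "N 0 = int b"
  shows "balanced_K (Suc n) N = (\<Sum>y\<in>comps n b. balanced_K n (\<lambda>i. N (Suc i) + int (y i)))"
proof -
  let ?N = "N(Suc n := - (\<Sum>i<Suc n. N i))"
  have "balanced_K (Suc n) N = (\<Sum>y\<in>comps n b. K n (\<lambda>i. ?N (Suc i) + int (y i)))"
    unfolding balanced_K_def balance_def by (rule K_peel) (simp add: assms)
  also have "\<dots> = (\<Sum>y\<in>comps n b. balanced_K n (\<lambda>i. N (Suc i) + int (y i)))"
  proof (intro sum.cong refl)
    fix y assume "y \<in> comps n b"
    then have "(\<Sum>i\<le>n. int (y i)) = int b"
      by (auto simp: comps_def simp flip: of_nat_sum)
    then have "(\<Sum>i<n. int (y i)) + int (y n) = int b"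
      by (simp add: lessThan_Suc_atMost[symmetric])
    then show "K n (\<lambda>i. ?N (Suc i) + int (y i)) = balanced_K n (\<lambda>i. N (Suc i) + int (y i))"
      unfolding balanced_K_def balance_def
      by (intro K_cong) (auto simp: sum.lessThan_Suc_shift assms sum.distrib simp del: sum.lessThan_Suc)
  qed
  finally show ?thesis .
qed

text \<open>A unit less at \<open>i\<close> is balanced by a unit more at the sink, as if one unit
  had used the edge \<open>(i, n)\<close>.\<close>

lemma balanced_K_mono_Suc:
  assumes "i < n"
  shows "balanced_K n (N(i := N i - 1)) \<le> balanced_K n N"
proof -
  let ?N = "N(n := - (\<Sum>k<n. N k))"
  have "(\<Sum>k<n. (N(i := N i - 1)) k) = (\<Sum>k<n. N k - (if k = i then 1 else 0))"
    by (intro sum.cong) auto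
  also have "\<dots> = (\<Sum>k<n. N k) - 1"
    using assms by (simp add: sum_subtractf)
  finally have "balanced_K n (N(i := N i - 1)) = K n (?N(i := ?N i - 1, n := ?N n + 1))"
    unfolding balanced_K_def balance_def using assms by (intro K_cong) auto
  also have "\<dots> \<le> balanced_K n N"
    unfolding balanced_K_def balance_def using assms by (rule K_edge_mono) simp
  finally show ?thesis .
qed

section \<open>The Catalan product\<close>

definition ksub :: "'a set \<Rightarrow> nat \<Rightarrow> 'a set set" where
  "ksub A k = {S. S \<subseteq> A \<and> card S = k}"

lemma finite_ksub: "finite A \<Longrightarrow> finite (ksub A k)"
  by (simp add: ksub_def)

text \<open>Each \<open>k\<close>-subset is counted once for every \<open>i\<close> in its
  complement.\<close>

lemma sum_ksub_remove:
  fixes F :: "'a set \<Rightarrow> int"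
  assumes A: "finite A"
  shows "(\<Sum>i\<in>A. \<Sum>S\<in>ksub (A - {i}) k. F S) = (int (card A) - int k) * (\<Sum>S\<in>ksub A k. F S)"
proof -
  have "(\<Sum>i\<in>A. \<Sum>S\<in>ksub (A - {i}) k. F S) = (\<Sum>i\<in>A. \<Sum>S\<in>{S \<in> ksub A k. i \<notin> S}. F S)"
    by (intro sum.cong) (auto simp: ksub_def)
  also have "\<dots> = (\<Sum>S\<in>ksub A k. \<Sum>i\<in>{i \<in> A. i \<notin> S}. F S)"
    using A finite_ksub[OF A] by (rule sum.swap_restrict)
  also have "\<dots> = (\<Sum>S\<in>ksub A k. (int (card A) - int k) * F S)"
  proof (intro sum.cong refl)
    fix S assume S: "S \<in> ksub A k"
    have "{i \<in> A. i \<notin> S} = A - S" by auto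
    moreover have "card (A - S) = card A - k" "k \<le> card A"
      using S A by (auto simp: ksub_def card_Diff_subset finite_subset card_mono)
    ultimately show "(\<Sum>i\<in>{i \<in> A. i \<notin> S}. F S) = (int (card A) - int k) * F S"
      by (simp add: of_nat_diff)
  qed
  finally show ?thesis by (simp add: sum_distrib_left)
qed

text \<open>Each subset of size \<open>k + 1\<close> is counted once for each of its elements
  \<open>i\<close>.\<close>

lemma sum_ksub_insert:
  fixes F :: "'a set \<Rightarrow> int"
  assumes A: "finite A"
  shows "(\<Sum>i\<in>A. \<Sum>S\<in>ksub (A - {i}) k. F (insert i S)) = (int k + 1) * (\<Sum>S\<in>ksub A (Suc k). F S)"
proof -
  have "(\<Sum>S\<in>ksub (A - {i}) k. F (insert i S)) = (\<Sum>S\<in>{S \<in> ksub A (Suc k). i \<in> S}. F S)"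
    if i: "i \<in> A" for i
  proof (rule sum.reindex_bij_witness[of _ "\<lambda>S. S - {i}" "insert i"])
    fix S assume "S \<in> ksub (A - {i}) k"
    then show "insert i S \<in> {S \<in> ksub A (Suc k). i \<in> S}"
      using i A by (auto simp: ksub_def) (meson card_insert_disjoint finite_Diff finite_subset subset_Diff_insert)
  qed (use A in \<open>auto simp: ksub_def\<close>)
  then have "(\<Sum>i\<in>A. \<Sum>S\<in>ksub (A - {i}) k. F (insert i S)) =
      (\<Sum>i\<in>A. \<Sum>S\<in>{S \<in> ksub A (Suc k). i \<in> S}. F S)"
    by (rule sum.cong[OF refl])
  also have "\<dots> = (\<Sum>S\<in>ksub A (Suc k). \<Sum>i\<in>{i \<in> A. i \<in> S}. F S)"
    using A finite_ksub[OF A] by (rule sum.swap_restrict)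
  also have "\<dots> = (\<Sum>S\<in>ksub A (Suc k). (int k + 1) * F S)"
  proof (intro sum.cong refl)
    fix S assume S: "S \<in> ksub A (Suc k)"
    then have "{i \<in> A. i \<in> S} = S" by (auto simp: ksub_def)
    then show "(\<Sum>i\<in>{i \<in> A. i \<in> S}. F S) = (int k + 1) * F S"
      using S by (simp add: ksub_def)
  qed
  finally show ?thesis by (simp add: sum_distrib_left)
qed

text \<open>Subsets are separated by whether they contain \<open>j\<close>. Writing the size as
  \<open>Suc (card U) = k\<close> makes the second sum empty for \<open>k = 0\<close>.\<close>

lemma sum_ksub_split:
  fixes F :: "'a set \<Rightarrow> int"
  assumes A: "finite A" and j: "j \<in> A"
  shows "(\<Sum>S\<in>ksub A k. F S) = (\<Sum>S\<in>ksub (A - {j}) k. F S) +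
    (\<Sum>U | U \<subseteq> A - {j} \<and> Suc (card U) = k. F (insert j U))"
proof -
  have "ksub A k = ksub (A - {j}) k \<union> {S \<in> ksub A k. j \<in> S}"
    by (auto simp: ksub_def)
  then have "(\<Sum>S\<in>ksub A k. F S) = (\<Sum>S\<in>ksub (A - {j}) k \<union> {S \<in> ksub A k. j \<in> S}. F S)"
    by simp
  also have "\<dots> = (\<Sum>S\<in>ksub (A - {j}) k. F S) + (\<Sum>S\<in>{S \<in> ksub A k. j \<in> S}. F S)"
    using A by (intro sum.union_disjoint) (auto simp: finite_ksub, auto simp: ksub_def)
  also have "(\<Sum>S\<in>{S \<in> ksub A k. j \<in> S}. F S) = (\<Sum>U | U \<subseteq> A - {j} \<and> Suc (card U) = k. F (insert j U))"
  proof (rule sum.reindex_bij_witness[of _ "insert j" "\<lambda>S. S - {j}"])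
    fix S assume "S \<in> {S \<in> ksub A k. j \<in> S}"
    then show "S - {j} \<in> {U. U \<subseteq> A - {j} \<and> Suc (card U) = k}"
      using A card_Suc_Diff1[of S j] finite_subset[of S A] by (auto simp: ksub_def simp del: card_Diff_insert)
  next
    fix U assume U: "U \<in> {U. U \<subseteq> A - {j} \<and> Suc (card U) = k}"
    then have "finite U" "j \<notin> U" using A finite_subset by auto
    then show "insert j U \<in> {S \<in> ksub A k. j \<in> S}"
      using U j by (auto simp: ksub_def)
  qed (use j in \<open>auto simp: insert_absorb\<close>)
  finally show ?thesis .
qed

lemma sum_off_diagonal_swap:
  assumes "finite A"
  shows "(\<Sum>i\<in>A. \<Sum>j\<in>A - {i}. h i j) = (\<Sum>i\<in>A. \<Sum>j\<in>A - {i}. h j i :: int)"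
proof -
  have "(\<Sum>i\<in>A. \<Sum>j\<in>A - {i}. h i j) = (\<Sum>i\<in>A. \<Sum>j\<in>{j \<in> A. i \<noteq> j}. h i j)"
    by (intro sum.cong) auto
  also have "\<dots> = (\<Sum>j\<in>A. \<Sum>i\<in>{i \<in> A. i \<noteq> j}. h i j)"
    using assms by (intro sum.swap_restrict)
  also have "\<dots> = (\<Sum>i\<in>A. \<Sum>j\<in>A - {i}. h j i)"
    by (intro sum.cong) auto
  finally show ?thesis .
qed

section \<open>The generating function and its derivatives in coefficients\<close>

text \<open>On coefficients, this shift is multiplication by \<open>x_i\<close>.\<close>

definition dec :: "(nat \<Rightarrow> int) \<Rightarrow> nat \<Rightarrow> nat \<Rightarrow> int" where
  "dec N i = N(i := N i - 1)"

lemma dec_commute: "dec (dec N i) j = dec (dec N j) i"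
  by (auto simp: dec_def fun_eq_iff)

lemma sum_upd:
  fixes N :: "nat \<Rightarrow> int"
  assumes "i < n"
  shows "(\<Sum>k<n. (N(i := x)) k) = (\<Sum>k<n. N k) - N i + x"
  using assms by (simp add: sum.remove[of "{..<n}" i])

text \<open>The coefficients of \<open>x_i F / (1 - x_i)\<close>: the edge \<open>(i, n)\<close> has
  \<open>z = x_i\<close>, as \<open>x_n = 1\<close>.\<close>

definition sink_flow :: "nat \<Rightarrow> nat \<Rightarrow> (nat \<Rightarrow> int) \<Rightarrow> int" where
  "sink_flow n i N = edge_flow n (balance n N) i n"

text \<open>With \<open>F = \<Sum>\<^sub>N balanced_K n N x\<^sup>N\<close>, these are the coefficients of \<open>F / (x\<^sub>j - x\<^sub>i)\<close>, expanded in
powers of \<open>x\<^sub>k / x\<^sub>l\<close> for \<open>k < l\<close>. Lemma \<open>quot_dec\<close> is multiplication by the denominator, and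
\<open>netflow_balanced_K\<close> computes \<open>x\<^sub>i \<partial>\<^sub>i F\<close>.\<close>

definition quot :: "nat \<Rightarrow> nat \<Rightarrow> nat \<Rightarrow> (nat \<Rightarrow> int) \<Rightarrow> int" where
  "quot n i j N = (if i < j then edge_flow n (balance n (N(i := N i + 1))) i j
     else - edge_flow n (balance n (N(j := N j + 1))) j i)"

lemma sink_flow_dec:
  assumes "i < n"
  shows "sink_flow n i N - sink_flow n i (dec N i) = int (balanced_K n (dec N i))"
proof -
  have "(balance n N)(i := balance n N i - 1, n := balance n N n + 1) = balance n (dec N i)"
    unfolding balance_def dec_def sum_upd[OF assms] using assms by (auto simp: fun_eq_iff)
  then show ?thesis
    using edge_flow_rec[of i n n "balance n N"] assms
    by (simp add: sink_flow_def balanced_K_def)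
qed

lemma quot_antisym: "i \<noteq> j \<Longrightarrow> quot n i j N = - quot n j i N"
  by (auto simp: quot_def)

text \<open>This is \<open>edge_flow_rec\<close> at \<open>?M\<close>: one unit moved along
  \<open>(i, j)\<close> turns \<open>?M\<close> into \<open>N\<close>, and the sink entry stays the
  same because both ends lie below \<open>n\<close>.\<close>

lemma quot_dec_less:
  assumes ij: "i < j" "j < n"
  shows "quot n i j (dec N j) - quot n i j (dec N i) = int (balanced_K n N)"
proof -
  let ?M = "(dec N j)(i := dec N j i + 1)"
  have "(\<Sum>k<n. ?M k) = (\<Sum>k<n. N k)"
    unfolding dec_def using ij by (subst sum_upd, simp, subst sum_upd) auto
  then have "(balance n ?M)(i := balance n ?M i - 1, j := balance n ?M j + 1) = balance n N"
    unfolding balance_def using ij by (auto simp: fun_eq_iff dec_def)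
  moreover have "(dec N i)(i := dec N i i + 1) = N"
    by (auto simp: dec_def)
  ultimately show ?thesis
    using edge_flow_rec[of i j n "balance n ?M"] ij
    by (simp add: quot_def balanced_K_def)
qed

lemma quot_dec:
  assumes "i \<noteq> j" "i < n" "j < n"
  shows "quot n i j (dec N j) - quot n i j (dec N i) = int (balanced_K n N)"
proof (cases "i < j")
  case True
  then show ?thesis using assms by (rule_tac quot_dec_less) auto
next
  case False
  then have "j < i" using assms by simp
  then show ?thesis
    using quot_dec_less[of j i n N] assms quot_antisym[of i j n] by simp
qed

lemma netflow_balanced_K:
  assumes i: "i < n"
  shows "(N i - int i) * int (balanced_K n N) =
    sink_flow n i N + (\<Sum>j\<in>{..<n} - {i}. quot n i j (dec N i))"
proof -
  have "(dec N k)(k := dec N k k + 1) = N" for k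
    by (auto simp: dec_def)
  then have ef: "edge_flow n (balance n N) k j = quot n k j (dec N k)" if "k < j" for k j
    using that by (simp add: quot_def)
  \<comment> \<open>For \<open>k < i\<close>, \<open>x_k / (x_i - x_k)\<close> equals
    \<open>x_i / (x_i - x_k) - 1\<close>; the \<open>i\<close> subtracted copies of \<open>F\<close>
    produce the \<open>- int i\<close> of the statement.\<close>
  have out: "edge_flow n (balance n N) k i = - quot n i k (dec N i) - int (balanced_K n N)" if "k < i" for k
    using quot_dec[of k i n N] quot_antisym[of i k n "dec N i"] that i ef[of k i] by simp
  have "{i<..n} = insert n {i<..<n}" using i by auto
  then have "(\<Sum>j\<in>{i<..n}. edge_flow n (balance n N) i j) =
      sink_flow n i N + (\<Sum>j\<in>{i<..<n}. quot n i j (dec N i))"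
    by (simp add: sink_flow_def ef)
  moreover have "(\<Sum>k<i. edge_flow n (balance n N) k i) =
      - (\<Sum>k<i. quot n i k (dec N i)) - int i * int (balanced_K n N)"
    by (simp add: out sum_subtractf sum_negf)
  moreover have "(\<Sum>j\<in>{..<n} - {i}. quot n i j (dec N i)) =
      (\<Sum>j\<in>{i<..<n}. quot n i j (dec N i)) + (\<Sum>k<i. quot n i k (dec N i))"
  proof -
    have *: "{..<n} - {i} = {i<..<n} \<union> {..<i}" using i by auto
    show ?thesis unfolding * by (rule sum.union_disjoint) auto
  qed
  moreover have b: "balance n N i = N i"
    using i by (simp add: balance_def)
  ultimately show ?thesis
    using netflow_times_K[of i n "balance n N"] i
    by (simp add: b left_diff_distrib flip: balanced_K_def)
qed

section \<open>Aomoto's recurrence for the staircase\<close>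

text \<open>For \<open>S\<close> below \<open>n\<close>, \<open>balanced_K n (stair S)\<close> is
  the coefficient of \<open>\<Prod>_i x_i^(i+1)\<close> in
  \<open>F \<Prod>_(i \<in> S) x_i\<close>.\<close>

definition stair :: "nat set \<Rightarrow> nat \<Rightarrow> int" where
  "stair S i = int i + 1 - of_bool (i \<in> S)"

text \<open>The coefficient of \<open>\<Prod>\<^sub>i x\<^sub>i\<^bsup>i+1\<^esup>\<close> in \<open>e\<^sub>k(x) F\<close>, where \<open>e\<^sub>k\<close> is the elementary symmetric polynomial.\<close>

definition stair_sum :: "nat \<Rightarrow> nat \<Rightarrow> int" where
  "stair_sum n k = (\<Sum>S\<in>ksub {..<n} k. int (balanced_K n (stair S)))"

lemma dec_stair: "i \<notin> S \<Longrightarrow> dec (stair S) i = stair (insert i S)"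
  by (auto simp: dec_def stair_def fun_eq_iff)

text \<open>Aomoto's argument: for \<open>\<Phi> = F / \<Prod>\<^sub>i x\<^sub>i\<^bsup>i+2\<^esup>\<close> the total derivative
\<open>\<Sum>\<^sub>i \<partial>\<^sub>i (x\<^sub>i (1 - x\<^sub>i) e\<^sub>k(x without x\<^sub>i) \<Phi>)\<close> has residue 0, and pairing the terms of \<open>(i, j)\<close> and \<open>(j, i)\<close>
clears the denominators \<open>x\<^sub>j - x\<^sub>i\<close>.\<close>

lemma stair_sum_rec:
  assumes k: "k < n"
  shows "(int n - int k) * (int n - int k + 1) * stair_sum n k =
    (int k + 1) * (2 * int n - int k) * stair_sum n (Suc k)"
proof -
  define A where "A = {..<n}"
  define G where "G S = int (balanced_K n (stair S))" for S
  \<comment> \<open>\<open>T i j S\<close> is the coefficient of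
    \<open>x_i (1 - x_i) F / (x_j - x_i)\<close> at the exponent \<open>stair S\<close>. Below,
    \<open>U i j\<close> indexes the sets that contain \<open>j\<close>, with \<open>j\<close> taken
    out.\<close>
  define T where "T i j S = quot n i j (dec (stair S) i) - quot n i j (dec (dec (stair S) i) i)" for i j S
  define Y where "Y i j = (\<Sum>S\<in>ksub (A - {i}) k. T i j S)" for i j
  define U where "U i j = {U. U \<subseteq> A - {i} - {j} \<and> Suc (card U) = k}" for i j
  have A: "finite A" "card A = n" by (auto simp: A_def)
  have W: "stair_sum n l = (\<Sum>S\<in>ksub A l. G S)" for l
    by (simp add: stair_sum_def A_def G_def)
  \<comment> \<open>Subtract the netflow equations at \<open>stair S\<close> and at
    \<open>dec (stair S) i\<close>: the factor \<open>N i - int i\<close> is 1 in the first and 0 in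
    the second, and the sink terms differ by \<open>G (insert i S)\<close>.\<close>
  have local: "G S = G (insert i S) + (\<Sum>j\<in>A - {i}. T i j S)" if "i \<in> A" "i \<notin> S" for i S
  proof -
    have i: "i < n" using that by (simp add: A_def)
    show ?thesis
      using netflow_balanced_K[OF i, of "stair S"] netflow_balanced_K[OF i, of "dec (stair S) i"]
        sink_flow_dec[OF i, of "stair S"] that
      by (simp add: dec_stair G_def T_def sum_subtractf flip: A_def) (simp add: stair_def)
  qed
  have "(int n - int k) * stair_sum n k = (\<Sum>i\<in>A. \<Sum>S\<in>ksub (A - {i}) k. G S)"
    using sum_ksub_remove[OF A(1)] A(2) W by simp
  also have "\<dots> = (\<Sum>i\<in>A. \<Sum>S\<in>ksub (A - {i}) k. G (insert i S) + (\<Sum>j\<in>A - {i}. T i j S))"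
    by (intro sum.cong refl local) (auto simp: ksub_def)
  also have "\<dots> = (\<Sum>i\<in>A. \<Sum>S\<in>ksub (A - {i}) k. G (insert i S)) +
      (\<Sum>i\<in>A. \<Sum>S\<in>ksub (A - {i}) k. \<Sum>j\<in>A - {i}. T i j S)"
    by (simp add: sum.distrib)
  also have "(\<Sum>i\<in>A. \<Sum>S\<in>ksub (A - {i}) k. \<Sum>j\<in>A - {i}. T i j S) = (\<Sum>i\<in>A. \<Sum>j\<in>A - {i}. Y i j)"
    unfolding Y_def by (intro sum.cong refl sum.swap)
  also have "(\<Sum>i\<in>A. \<Sum>S\<in>ksub (A - {i}) k. G (insert i S)) = (int k + 1) * stair_sum n (Suc k)"
    unfolding W by (rule sum_ksub_insert[OF A(1)])
  finally have 1: "(int n - int k) * stair_sum n k =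
      (int k + 1) * stair_sum n (Suc k) + (\<Sum>i\<in>A. \<Sum>j\<in>A - {i}. Y i j)" .

  have Y: "Y i j + Y j i =
      (\<Sum>S\<in>ksub (A - {i} - {j}) k. G (insert i S)) + (\<Sum>S\<in>ksub (A - {i} - {j}) k. G (insert j S))
      - (\<Sum>S\<in>ksub (A - {i} - {j}) k. G S) + (\<Sum>V\<in>U i j. G (insert i (insert j V)))"
    if ij: "i \<in> A" "j \<in> A - {i}" for i j
  proof -
    have q: "quot n i j (dec N j) - quot n i j (dec N i) = int (balanced_K n N)" for N
      using ij by (intro quot_dec) (auto simp: A_def)
    have anti: "quot n j i N = - quot n i j N" for N
      using ij by (intro quot_antisym) auto
    have "A - {j} - {i} = A - {i} - {j}" by auto
    then have split: "Y i j = (\<Sum>S\<in>ksub (A - {i} - {j}) k. T i j S) + (\<Sum>V\<in>U i j. T i j (insert j V))"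
      "Y j i = (\<Sum>S\<in>ksub (A - {i} - {j}) k. T j i S) + (\<Sum>V\<in>U i j. T j i (insert i V))"
      unfolding Y_def U_def
      using sum_ksub_split[of "A - {i}" j "T i j"] sum_ksub_split[of "A - {j}" i "T j i"] A(1) ij by auto
    \<comment> \<open>Here
      \<open>x_i (1 - x_i) - x_j (1 - x_j) = (x_j - x_i) (x_i + x_j - 1)\<close> cancels the
      denominator.\<close>
    have a: "T i j S + T j i S = G (insert i S) + G (insert j S) - G S"
      if "S \<in> ksub (A - {i} - {j}) k" for S
    proof -
      have "i \<notin> S" "j \<notin> S" using that by (auto simp: ksub_def)
      then show ?thesis
        using q[of "stair S"] q[of "dec (stair S) i"] q[of "dec (stair S) j"]
          dec_commute[of "stair S" i j]
        by (simp add: T_def anti G_def flip: dec_stair)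
    qed
    \<comment> \<open>Here
      \<open>x_j x_i (1 - x_i) - x_i x_j (1 - x_j) = (x_j - x_i) x_i x_j\<close>.\<close>
    have b: "T i j (insert j V) + T j i (insert i V) = G (insert i (insert j V))"
      if "V \<in> U i j" for V
    proof -
      have V: "i \<notin> V" "j \<notin> V" "i \<noteq> j" using that ij by (auto simp: U_def)
      then have e: "stair (insert j V) = dec (stair V) j" "stair (insert i V) = dec (stair V) i"
        "stair (insert i (insert j V)) = dec (dec (stair V) i) j"
        using dec_commute by (auto simp flip: dec_stair)
      show ?thesis
        using q[of "dec (dec (stair V) i) j"] dec_commute[of _ i j]
        by (simp add: T_def anti G_def e)
    qed
    have "Y i j + Y j i = (\<Sum>S\<in>ksub (A - {i} - {j}) k. T i j S + T j i S) +
        (\<Sum>V\<in>U i j. T i j (insert j V) + T j i (insert i V))"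
      unfolding split by (simp add: sum.distrib)
    also have "\<dots> = (\<Sum>S\<in>ksub (A - {i} - {j}) k. G (insert i S) + G (insert j S) - G S) +
        (\<Sum>V\<in>U i j. G (insert i (insert j V)))"
      using a b by simp
    finally show ?thesis by (simp add: sum.distrib sum_subtractf)
  qed
  have c: "card (A - {i}) = n - 1" "finite (A - {i})" if "i \<in> A" for i
    using that A by auto
  have s1: "(\<Sum>i\<in>A. \<Sum>j\<in>A - {i}. \<Sum>S\<in>ksub (A - {i} - {j}) k. F i S) =
      (int n - 1 - int k) * (\<Sum>i\<in>A. \<Sum>S\<in>ksub (A - {i}) k. F i S)" for F
  proof -
    have "(\<Sum>j\<in>A - {i}. \<Sum>S\<in>ksub (A - {i} - {j}) k. F i S) =
        (int n - 1 - int k) * (\<Sum>S\<in>ksub (A - {i}) k. F i S)" if "i \<in> A" for i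
      using sum_ksub_remove[OF c(2)[OF that], of "F i" k] c(1)[OF that] k by (simp add: of_nat_diff)
    then show ?thesis
      unfolding sum_distrib_left by (rule sum.cong[OF refl])
  qed
  have s2: "(\<Sum>i\<in>A. \<Sum>j\<in>A - {i}. \<Sum>S\<in>ksub (A - {i} - {j}) k. G (insert i S)) =
      (int n - 1 - int k) * (int k + 1) * stair_sum n (Suc k)"
    unfolding s1 W by (simp add: sum_ksub_insert A)
  have "(\<Sum>i\<in>A. \<Sum>j\<in>A - {i}. \<Sum>S\<in>ksub (A - {i} - {j}) k. G (insert j S)) =
      (\<Sum>i\<in>A. \<Sum>j\<in>A - {i}. \<Sum>S\<in>ksub (A - {j} - {i}) k. G (insert i S))"
    by (rule sum_off_diagonal_swap) fact
  also have "\<dots> = (\<Sum>i\<in>A. \<Sum>j\<in>A - {i}. \<Sum>S\<in>ksub (A - {i} - {j}) k. G (insert i S))"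
    by (intro sum.cong refl) (auto simp: ksub_def)
  finally have s3: "(\<Sum>i\<in>A. \<Sum>j\<in>A - {i}. \<Sum>S\<in>ksub (A - {i} - {j}) k. G (insert j S)) =
      (int n - 1 - int k) * (int k + 1) * stair_sum n (Suc k)"
    unfolding s2 .
  have s4: "(\<Sum>i\<in>A. \<Sum>j\<in>A - {i}. \<Sum>S\<in>ksub (A - {i} - {j}) k. G S) =
      (int n - 1 - int k) * (int n - int k) * stair_sum n k"
    unfolding s1 W by (simp add: sum_ksub_remove A)
  have s5: "(\<Sum>i\<in>A. \<Sum>j\<in>A - {i}. \<Sum>V\<in>U i j. G (insert i (insert j V))) =
      int k * (int k + 1) * stair_sum n (Suc k)"
  proof (cases k)
    case 0
    then show ?thesis by (simp add: U_def)
  next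
    case (Suc l)
    \<comment> \<open>Each \<open>k\<close>-subset of \<open>A - {i}\<close> arises \<open>k\<close>
      times as \<open>insert j V\<close>.\<close>
    have "(\<Sum>j\<in>A - {i}. \<Sum>V\<in>U i j. G (insert i (insert j V))) =
        int k * (\<Sum>S\<in>ksub (A - {i}) k. G (insert i S))" if "i \<in> A" for i
      using sum_ksub_insert[of "A - {i}" "\<lambda>S. G (insert i S)" l] A(1)
      by (simp add: U_def Suc ksub_def)
    then have "(\<Sum>i\<in>A. \<Sum>j\<in>A - {i}. \<Sum>V\<in>U i j. G (insert i (insert j V))) =
        int k * (\<Sum>i\<in>A. \<Sum>S\<in>ksub (A - {i}) k. G (insert i S))"
      by (simp add: sum_distrib_left)
    then show ?thesis
      unfolding W by (simp add: sum_ksub_insert A)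
  qed
  \<comment> \<open>Adding the sum to its swapped copy leaves only the pairs
    \<open>Y i j + Y j i\<close>, which have no denominators.\<close>
  have "2 * (\<Sum>i\<in>A. \<Sum>j\<in>A - {i}. Y i j) = (\<Sum>i\<in>A. \<Sum>j\<in>A - {i}. Y i j + Y j i)"
    using sum_off_diagonal_swap[OF A(1), of Y] by (simp add: sum.distrib)
  also have "\<dots> = 2 * ((int n - 1 - int k) * (int k + 1) * stair_sum n (Suc k))
      - (int n - 1 - int k) * (int n - int k) * stair_sum n k + int k * (int k + 1) * stair_sum n (Suc k)"
    by (simp add: Y sum.distrib sum_subtractf s2 s3 s4 s5)
  finally show ?thesis
    using 1 by (simp add: algebra_simps)
qed

section \<open>Solution of the recurrence and Catalan numbers\<close>

text \<open>Vertex 0 of the staircase \<open>0, 1, ..., n\<close> has supply 0; peeling it off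
  leaves \<open>1, ..., n\<close>.\<close>

lemma stair_sum_0: "stair_sum n 0 = int (balanced_K (Suc n) int)"
proof -
  have "ksub {..<n} 0 = {{}}"
    by (auto simp: ksub_def finite_subset)
  moreover have "comps n 0 = {\<lambda>_. 0}"
    by (auto simp: comps_def fun_eq_iff) (metis atMost_iff not_le)
  moreover have "stair {} = (\<lambda>i. int (Suc i))"
    by (auto simp: stair_def)
  ultimately show ?thesis
    by (simp add: stair_sum_def balanced_K_peel[of int 0])
qed

text \<open>Lowering every entry of \<open>1, ..., n\<close> gives \<open>0, ..., n - 1\<close>, so
  the two ends of the recurrence in \<open>k\<close> link consecutive staircases.\<close>

lemma stair_sum_full: "stair_sum n n = int (balanced_K n int)"
proof -
  have "ksub {..<n} n = {{..<n}}"
    using card_subset_eq[of "{..<n}"] by (auto simp: ksub_def)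
  then show ?thesis
    by (simp add: stair_sum_def stair_def cong: balanced_K_cong)
qed

text \<open>The two-term recurrence multiplied out, with all denominators cleared to stay in the
  integers.\<close>

lemma stair_sum_closed:
  assumes "k \<le> n"
  shows "stair_sum n k * (fact k * fact (2 * n) * fact (n + 1 - k) * fact (n - k)) =
    stair_sum n 0 * (fact (n + 1) * fact n * fact (2 * n - k))"
  using assms
proof (induction k)
  case (Suc k)
  define m where "m = n - Suc k"
  have n: "n = m + Suc k" using Suc.prems by (simp add: m_def)
  \<comment> \<open>\<open>?c\<close> raises \<open>fact (Suc m) * fact m\<close> and
    \<open>fact (n + m)\<close> to the factorials that occur at \<open>k\<close>.\<close>
  let ?c = "(int m + 1) * (int m + 2) * (int n + int m + 1)"
  have rec: "(int m + 1) * (int m + 2) * stair_sum n k = (int k + 1) * (int n + int m + 1) * stair_sum n (Suc k)"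
    using stair_sum_rec[of k n] n by (simp add: algebra_simps)
  have fs: "n - k = Suc m" "n + 1 - k = Suc (Suc m)" "2 * n - k = Suc (n + m)" "n - Suc k = m"
    "n + 1 - Suc k = Suc m" "2 * n - Suc k = n + m"
    using n by auto
  have IH: "stair_sum n k * (fact k * fact (2 * n) * fact (Suc (Suc m)) * fact (Suc m)) =
      stair_sum n 0 * (fact (n + 1) * fact n * fact (Suc (n + m)))"
    using Suc.IH Suc.prems unfolding fs by simp
  have "?c * (stair_sum n (Suc k) * (fact (Suc k) * fact (2 * n) * fact (Suc m) * fact m)) =
      ((int k + 1) * (int n + int m + 1) * stair_sum n (Suc k)) *
        (fact k * fact (2 * n) * fact (Suc (Suc m)) * fact (Suc m))"
    by (simp add: algebra_simps)
  also have "\<dots> = (int m + 1) * (int m + 2) *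
      (stair_sum n k * (fact k * fact (2 * n) * fact (Suc (Suc m)) * fact (Suc m)))"
    unfolding rec[symmetric] by (simp only: mult_ac)
  also have "\<dots> = ?c * (stair_sum n 0 * (fact (n + 1) * fact n * fact (n + m)))"
    unfolding IH by (simp add: algebra_simps)
  finally have "?c * (stair_sum n (Suc k) * (fact (Suc k) * fact (2 * n) * fact (Suc m) * fact m)) =
    ?c * (stair_sum n 0 * (fact (n + 1) * fact n * fact (n + m)))" .
  moreover have "?c \<noteq> 0" by simp
  ultimately show ?case
    unfolding fs by (simp only: mult_cancel_left simp_thms)
qed simp

text \<open>The \<open>div\<close> in \<open>catalan\<close> is exact: \<open>n + 1\<close> divides
  \<open>n * ((2 * n) choose n)\<close> by absorption and is coprime to \<open>n\<close>.\<close>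

lemma catalan_fact: "catalan n * (fact (n + 1) * fact n) = fact (2 * n)"
proof -
  have "Suc n * ((2 * n) choose Suc n) = n * ((2 * n) choose n)"
    using binomial_absorption[of n "2 * n"] binomial_absorb_comp[of "2 * n" n]
    by (cases "n = 0") simp_all
  then have "Suc n dvd n * ((2 * n) choose n)"
    by (metis dvd_triv_left)
  moreover have "coprime (Suc n) n" by simp
  ultimately have "Suc n dvd ((2 * n) choose n)"
    by (metis coprime_dvd_mult_right_iff)
  then have "catalan n * Suc n = (2 * n) choose n"
    by (simp only: catalan_def Suc_eq_plus1[symmetric] dvd_div_mult_self)
  moreover have "fact n * fact n * ((2 * n) choose n) = fact (2 * n)"
    using binomial_fact_lemma[of n "2 * n"] by (simp add: mult_2)
  moreover have "catalan n * (fact (n + 1) * fact n) = fact n * fact n * (catalan n * Suc n)"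
    by (simp only: Suc_eq_plus1[symmetric] fact_Suc of_nat_id mult_ac)
  ultimately show ?thesis by simp
qed

text \<open>The closed form at \<open>k = n\<close> makes the ratio of \<open>stair_sum n 0\<close>
  to \<open>stair_sum n n\<close> equal to \<open>(2n)! / ((n+1)! n!)\<close>.\<close>

lemma balanced_K_Suc_stair: "balanced_K (Suc n) int = balanced_K n int * catalan n"
proof -
  have "stair_sum n n * fact (2 * n) = stair_sum n 0 * (fact (n + 1) * fact n)"
  proof -
    have "fact n * (stair_sum n n * fact (2 * n)) = fact n * (stair_sum n 0 * (fact (n + 1) * fact n))"
      using stair_sum_closed[of n n] by (simp add: mult_ac del: fact_Suc)
    moreover have "fact n \<noteq> (0 :: int)" by simp
    ultimately show ?thesis by (metis mult_left_cancel)
  qed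
  then have "int (balanced_K n int) * fact (2 * n) = int (balanced_K (Suc n) int) * (fact (n + 1) * fact n)"
    by (simp only: stair_sum_0 stair_sum_full)
  then have "int (balanced_K n int * fact (2 * n)) = int (balanced_K (Suc n) int * (fact (n + 1) * fact n))"
    by (simp only: of_nat_mult of_nat_fact)
  then have "balanced_K n int * fact (2 * n) = balanced_K (Suc n) int * (fact (n + 1) * fact n)"
    by (simp only: of_nat_eq_iff)
  then have "balanced_K (Suc n) int * (fact (n + 1) * fact n) = (balanced_K n int * catalan n) * (fact (n + 1) * fact n)"
    by (simp only: catalan_fact[symmetric] mult.assoc)
  moreover have "fact (n + 1) * fact n \<noteq> (0 :: nat)"
    by simp
  ultimately show ?thesis
    using mult_right_cancel by blast
qed

lemma balanced_K_stair: "balanced_K n int = (\<Prod>i<n. catalan i)"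
proof (induction n)
  case 0
  then show ?case by (simp add: balanced_K_0)
next
  case (Suc n)
  then show ?case by (simp only: balanced_K_Suc_stair prod.lessThan_Suc)
qed

section \<open>The Lidskii expansion\<close>

lemma comps_0: "comps 0 T = {\<lambda>i. if i = 0 then T else 0}"
  by (auto simp: comps_def fun_eq_iff)

lemma sum_comps_Suc:
  "(\<Sum>d\<in>comps (Suc q) b. h d) = (\<Sum>k\<le>b. \<Sum>d\<in>comps q (b - k). h (d(Suc q := k)))"
proof -
  have "(\<Sum>d\<in>comps (Suc q) b. h d) =
      (\<Sum>(k, d)\<in>(SIGMA k:{..b}. comps q (b - k)). h (d(Suc q := k)))"
  proof (rule sum.reindex_bij_witness[of _ "\<lambda>(k, d). d(Suc q := k)" "\<lambda>d. (d (Suc q), d(Suc q := 0))"])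
    fix d assume d: "d \<in> comps (Suc q) b"
    have "(\<Sum>i\<le>q. (d(Suc q := 0)) i) = (\<Sum>i\<le>q. d i)"
      by (intro sum.cong) auto
    then show "(d (Suc q), d(Suc q := 0)) \<in> (SIGMA k:{..b}. comps q (b - k))"
      using d by (auto simp: comps_def)
  next
    fix p assume p: "p \<in> (SIGMA k:{..b}. comps q (b - k))"
    obtain k d where kd: "p = (k, d)" by fastforce
    have "(\<Sum>i\<le>q. (d(Suc q := k)) i) = (\<Sum>i\<le>q. d i)"
      by (intro sum.cong) auto
    then show "(case p of (k, d) \<Rightarrow> d(Suc q := k)) \<in> comps (Suc q) b"
      using p by (auto simp: comps_def kd)
    show "(\<lambda>d. (d (Suc q), d(Suc q := 0))) (case p of (k, d) \<Rightarrow> d(Suc q := k)) = p"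
      using p by (auto simp: comps_def kd fun_eq_iff)
  qed auto
  then show ?thesis
    by (simp add: sum.Sigma finite_comps)
qed

lemma vandermonde_comps:
  "(\<Sum>d\<in>comps q b. \<Prod>i\<le>q. y i choose d i) = (\<Sum>i\<le>q. y i) choose b"
proof (induction q arbitrary: b)
  case 0
  show ?case by (simp add: comps_0)
next
  case (Suc q)
  have "(\<Sum>d\<in>comps (Suc q) b. \<Prod>i\<le>Suc q. y i choose d i) =
      (\<Sum>k\<le>b. \<Sum>d\<in>comps q (b - k). (y (Suc q) choose k) * (\<Prod>i\<le>q. y i choose d i))"
    unfolding sum_comps_Suc by (intro sum.cong refl) (simp add: mult.commute)
  also have "\<dots> = (\<Sum>k\<le>b. (y (Suc q) choose k) * ((\<Sum>i\<le>q. y i) choose (b - k)))"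
    by (simp add: Suc.IH flip: sum_distrib_left)
  also have "\<dots> = (\<Sum>i\<le>Suc q. y i) choose b"
    by (simp add: vandermonde add.commute)
  finally show ?case .
qed

text \<open>Vandermonde's identity with the summation index reflected to \<open>p - s\<close>; the
  terms with index above \<open>p\<close> vanish.\<close>

lemma vandermonde_shift: "(\<Sum>s\<le>p. (p choose s) * (m choose (c + s))) = (m + p) choose (c + p)"
proof -
  have "(m + p) choose (c + p) = (\<Sum>k\<le>c + p. (p choose k) * (m choose (c + p - k)))"
    by (simp add: vandermonde add.commute)
  also have "\<dots> = (\<Sum>k\<le>p. (p choose k) * (m choose (c + p - k)))"
    by (rule sum.mono_neutral_right) auto
  also have "\<dots> = (\<Sum>s\<le>p. (p choose s) * (m choose (c + s)))"
    by (rule sum.reindex_bij_witness[of _ "\<lambda>s. p - s" "\<lambda>s. p - s"])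
      (auto simp: binomial_symmetric[symmetric])
  finally show ?thesis by simp
qed

text \<open>The coefficient of \<open>x^n\<close> in
  \<open>x^d / (1-x)^(d+1) * x^m / (1-x)^(m+1)\<close>, proved here by Pascal's rule.\<close>

lemma sum_choose_convolution:
  "(\<Sum>k\<le>n. (k choose d) * ((n - k) choose m)) = Suc n choose Suc (d + m)"
proof (induction n arbitrary: m)
  case (Suc n)
  show ?case
  proof (cases m)
    case 0
    then show ?thesis using sum_choose_upper[of d "Suc n"] by simp
  next
    case (Suc l)
    have "(\<Sum>k\<le>Suc n. (k choose d) * ((Suc n - k) choose m)) =
        (\<Sum>k\<le>n. (k choose d) * ((n - k) choose l) + (k choose d) * ((n - k) choose m))"
      by (simp add: Suc Suc_diff_le distrib_left)
    also have "\<dots> = Suc (Suc n) choose Suc (d + m)"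
      using Suc.IH[of l] Suc.IH[of m] by (simp add: sum.distrib Suc)
    finally show ?thesis .
  qed
qed (cases d; cases m; simp)

lemma sum_choose_convolution_shift:
  "(\<Sum>k\<le>Z. (k choose d) * ((Z - k + p) choose (e + p))) = (Z + Suc p) choose (d + e + Suc p)"
proof -
  have "(\<Sum>k\<le>Z. (k choose d) * ((Z - k + p) choose (e + p))) =
      (\<Sum>k\<le>Z. (k choose d) * ((Z + p - k) choose (e + p)))"
    by (intro sum.cong) auto
  \<comment> \<open>For \<open>k > Z\<close> the upper entry \<open>Z + p - k\<close> is below
    \<open>p\<close>, so the new terms vanish.\<close>
  also have "\<dots> = (\<Sum>k\<le>Z + p. (k choose d) * ((Z + p - k) choose (e + p)))"
    by (rule sum.mono_neutral_left) auto
  finally show ?thesis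
    by (simp add: sum_choose_convolution add_ac)
qed

section \<open>Elimination of one vertex in the expansion\<close>

text \<open>For arrivals \<open>Z\<close>, these are the amounts that the vertex being eliminated
  may have contributed to them.\<close>

definition box :: "nat \<Rightarrow> (nat \<Rightarrow> nat) \<Rightarrow> (nat \<Rightarrow> nat) set" where
  "box q Z = {y. (\<forall>i>q. y i = 0) \<and> (\<forall>i\<le>q. y i \<le> Z i)}"

lemma sum_box_prod:
  fixes g :: "nat \<Rightarrow> nat \<Rightarrow> nat"
  shows "(\<Sum>y\<in>box q Z. \<Prod>i\<le>q. g i (y i)) = (\<Prod>i\<le>q. \<Sum>k\<le>Z i. g i k)"
proof -
  have "(\<Sum>y\<in>box q Z. \<Prod>i\<le>q. g i (y i)) = (\<Sum>y\<in>PiE {..q} (\<lambda>i. {..Z i}). \<Prod>i\<le>q. g i (y i))"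
    by (rule sum.reindex_bij_witness[of _ "\<lambda>f i. if i \<le> q then f i else 0" "\<lambda>y. restrict y {..q}"])
      (auto simp: box_def fun_eq_iff PiE_def extensional_def intro!: prod.cong)
  then show ?thesis
    by (simp add: prod_sum_PiE)
qed

lemma finite_box: "finite (box q Z)"
proof (rule finite_subset)
  show "box q Z \<subseteq> (\<Union>T\<le>\<Sum>i\<le>q. Z i. comps q T)"
    by (auto simp: box_def comps_def intro!: sum_mono)
qed (auto simp: finite_comps)

text \<open>The state after the elimination of \<open>p + 1\<close> vertices: \<open>Y i\<close> is the flow that has arrived at the
\<open>i\<close>-th of the remaining \<open>q + 1\<close> vertices, the last of which is the sink.\<close>

definition lidskii_sum :: "nat \<Rightarrow> nat \<Rightarrow> (nat \<Rightarrow> nat) \<Rightarrow> nat \<Rightarrow> nat" where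
  "lidskii_sum q p e T = (\<Sum>Y\<in>comps q T.
     (\<Prod>i\<le>q. (Y i + p) choose (e i + p)) * balanced_K q (\<lambda>i. int (Y i)))"

lemma lidskii_sum_0: "lidskii_sum 0 p e T = (T + p) choose (e 0 + p)"
  by (simp add: lidskii_sum_def comps_0 balanced_K_0)

text \<open>\<open>vandermonde_shift\<close> removes the shift \<open>p\<close> from the first
  binomial and \<open>vandermonde_comps\<close> distributes its lower entry over the receivers as
  \<open>d\<close>. The sum over \<open>y\<close> then factors over \<open>i\<close>, and each
  convolution turns \<open>p\<close> into \<open>p + 1\<close>.\<close>

lemma sum_box_lidskii:
  "(\<Sum>y\<in>box q Z. (((\<Sum>i\<le>q. y i) + p) choose (c + p)) * (\<Prod>i\<le>q. (Z i - y i + p) choose (e i + p))) =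
    (\<Sum>s\<le>p. (p choose s) * (\<Sum>d\<in>comps q (c + s). \<Prod>i\<le>q. (Z i + Suc p) choose (e i + d i + Suc p)))"
proof -
  let ?P = "\<lambda>y. \<Prod>i\<le>q. (Z i - y i + p) choose (e i + p)"
  have "(\<Sum>y\<in>box q Z. (((\<Sum>i\<le>q. y i) + p) choose (c + p)) * ?P y) =
      (\<Sum>y\<in>box q Z. \<Sum>s\<le>p. \<Sum>d\<in>comps q (c + s). (p choose s) * ((\<Prod>i\<le>q. y i choose d i) * ?P y))"
    unfolding vandermonde_shift[symmetric] vandermonde_comps[symmetric]
    by (simp add: sum_distrib_left sum_distrib_right mult.assoc)
  also have "\<dots> = (\<Sum>s\<le>p. \<Sum>y\<in>box q Z. \<Sum>d\<in>comps q (c + s). (p choose s) * ((\<Prod>i\<le>q. y i choose d i) * ?P y))"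
    by (rule sum.swap)
  also have "\<dots> = (\<Sum>s\<le>p. \<Sum>d\<in>comps q (c + s). \<Sum>y\<in>box q Z. (p choose s) * ((\<Prod>i\<le>q. y i choose d i) * ?P y))"
    by (intro sum.cong refl sum.swap)
  also have "\<dots> = (\<Sum>s\<le>p. \<Sum>d\<in>comps q (c + s).
      (p choose s) * (\<Sum>y\<in>box q Z. \<Prod>i\<le>q. (y i choose d i) * ((Z i - y i + p) choose (e i + p))))"
    by (simp add: sum_distrib_left prod.distrib)
  also have "\<dots> = (\<Sum>s\<le>p. (p choose s) * (\<Sum>d\<in>comps q (c + s). \<Prod>i\<le>q. (Z i + Suc p) choose (e i + d i + Suc p)))"
  proof -
    have "(\<Sum>y\<in>box q Z. \<Prod>i\<le>q. (y i choose d i) * ((Z i - y i + p) choose (e i + p))) =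
        (\<Prod>i\<le>q. (Z i + Suc p) choose (e i + d i + Suc p))" for d
      using sum_box_prod[of "\<lambda>i k. (k choose d i) * ((Z i - k + p) choose (e i + p))" q Z]
      by (simp only: sum_choose_convolution_shift add.commute[of "d _" "e _"])
    then show ?thesis
      by (simp only: sum_distrib_left)
  qed
  finally show ?thesis .
qed

text \<open>After peeling vertex 0, pass to the arrivals \<open>Z i = Y (Suc i) + y i\<close>. The
  factor \<open>?K Z\<close> depends on \<open>Z\<close> only and \<open>Y 0\<close> is the total of
  \<open>y\<close>, so \<open>sum_box_lidskii\<close> evaluates the sum over
  \<open>y\<close>.\<close>

lemma lidskii_sum_Suc:
  "lidskii_sum (Suc q) p e T =
    (\<Sum>s\<le>p. (p choose s) * (\<Sum>d\<in>comps q (e 0 + s). lidskii_sum q (Suc p) (\<lambda>i. e (Suc i) + d i) T))"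
proof -
  let ?K = "\<lambda>Z. balanced_K q (\<lambda>i. int (Z i))"
  let ?F = "\<lambda>Z y. (((\<Sum>i\<le>q. y i) + p) choose (e 0 + p)) *
      (\<Prod>i\<le>q. (Z i - y i + p) choose (e (Suc i) + p)) * ?K Z"
  have "lidskii_sum (Suc q) p e T = (\<Sum>Y\<in>comps (Suc q) T. \<Sum>y\<in>comps q (Y 0).
      ((Y 0 + p) choose (e 0 + p)) * (\<Prod>i\<le>q. (Y (Suc i) + p) choose (e (Suc i) + p)) *
      ?K (\<lambda>i. Y (Suc i) + y i))"
    unfolding lidskii_sum_def
  proof (intro sum.cong refl)
    fix Y
    show "(\<Prod>i\<le>Suc q. (Y i + p) choose (e i + p)) * balanced_K (Suc q) (\<lambda>i. int (Y i)) =
      (\<Sum>y\<in>comps q (Y 0). ((Y 0 + p) choose (e 0 + p)) *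
        (\<Prod>i\<le>q. (Y (Suc i) + p) choose (e (Suc i) + p)) * ?K (\<lambda>i. Y (Suc i) + y i))"
      by (subst balanced_K_peel[of _ "Y 0"])
        (simp_all add: prod.atMost_Suc_shift sum_distrib_left del: prod.atMost_Suc)
  qed
  also have "\<dots> = (\<Sum>(Y, y)\<in>(SIGMA Y:comps (Suc q) T. comps q (Y 0)).
      ((Y 0 + p) choose (e 0 + p)) * (\<Prod>i\<le>q. (Y (Suc i) + p) choose (e (Suc i) + p)) *
      ?K (\<lambda>i. Y (Suc i) + y i))"
    by (rule sum.Sigma) (auto simp: finite_comps)
  also have "\<dots> = (\<Sum>(Z, y)\<in>(SIGMA Z:comps q T. box q Z). ?F Z y)"
  \<comment> \<open>The inverse takes \<open>Y 0\<close> as the total of \<open>y\<close> and the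
    other entries as \<open>Z i - y i\<close>, a true difference since \<open>y\<close> lies in
    \<open>box q Z\<close>.\<close>
  proof (rule sum.reindex_bij_witness[of _
        "\<lambda>(Z, y). (\<lambda>i. case i of 0 \<Rightarrow> \<Sum>i\<le>q. y i | Suc i \<Rightarrow> Z i - y i, y)"
        "\<lambda>(Y, y). (\<lambda>i. Y (Suc i) + y i, y)"], goal_cases)
    case (1 a)
    then show ?case
      by (auto simp: comps_def fun_eq_iff split: nat.splits)
  next
    case (2 a)
    then show ?case
      by (auto simp: comps_def box_def sum.distrib sum.atMost_Suc_shift simp del: sum.atMost_Suc)
  next
    case (3 b)
    obtain Z y where b: "b = (Z, y)" by fastforce
    have "y i \<le> Z i" for i
      using 3 by (cases "i \<le> q") (auto simp: b box_def)
    then show ?case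
      by (auto simp: b)
  next
    case (4 b)
    obtain Z y where b: "b = (Z, y)" by fastforce
    have "(\<Sum>i\<le>q. Z i - y i) + (\<Sum>i\<le>q. y i) = (\<Sum>i\<le>q. Z i)"
      using 4 by (auto simp: b box_def simp flip: sum.distrib intro!: sum.cong)
    then show ?case
      using 4 by (auto simp: b comps_def box_def sum.atMost_Suc_shift split: nat.splits simp del: sum.atMost_Suc)
  next
    case (5 a)
    then show ?case
      by (auto simp: comps_def)
  qed
  also have "\<dots> = (\<Sum>Z\<in>comps q T. \<Sum>y\<in>box q Z. ?F Z y)"
    by (rule sum.Sigma[symmetric]) (auto simp: finite_comps finite_box)
  also have "\<dots> = (\<Sum>Z\<in>comps q T. (\<Sum>s\<le>p. (p choose s) *
      (\<Sum>d\<in>comps q (e 0 + s). \<Prod>i\<le>q. (Z i + Suc p) choose (e (Suc i) + d i + Suc p))) * ?K Z)"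
    unfolding sum_box_lidskii[symmetric] by (simp only: sum_distrib_right)
  also have "\<dots> = (\<Sum>Z\<in>comps q T. \<Sum>s\<le>p. \<Sum>d\<in>comps q (e 0 + s). (p choose s) *
      ((\<Prod>i\<le>q. (Z i + Suc p) choose (e (Suc i) + d i + Suc p)) * ?K Z))"
    by (simp only: sum_distrib_left sum_distrib_right mult.assoc)
  also have "\<dots> = (\<Sum>s\<le>p. \<Sum>Z\<in>comps q T. \<Sum>d\<in>comps q (e 0 + s). (p choose s) *
      ((\<Prod>i\<le>q. (Z i + Suc p) choose (e (Suc i) + d i + Suc p)) * ?K Z))"
    by (rule sum.swap)
  also have "\<dots> = (\<Sum>s\<le>p. \<Sum>d\<in>comps q (e 0 + s). \<Sum>Z\<in>comps q T. (p choose s) *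
      ((\<Prod>i\<le>q. (Z i + Suc p) choose (e (Suc i) + d i + Suc p)) * ?K Z))"
    by (intro sum.cong refl sum.swap)
  finally show ?thesis
    unfolding lidskii_sum_def by (simp only: sum_distrib_left)
qed

section \<open>Bounds from the expansion\<close>

lemma balanced_K_mono_0:
  assumes "a \<le> b" "0 < n"
  shows "balanced_K n (N(0 := int a)) \<le> balanced_K n (N(0 := int b))"
  using assms(1)
proof (induction b rule: dec_induct)
  case (step b)
  have "balanced_K n (N(0 := int b)) \<le> balanced_K n (N(0 := int (Suc b)))"
    using balanced_K_mono_Suc[of 0 n "N(0 := int (Suc b))"] assms(2) by simp
  with step.IH show ?case by (rule order_trans)
qed simp

text \<open>\<open>balanced_K_peel\<close> read from right to left, with
  \<open>Suc p + i = p + Suc i\<close>.\<close>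

lemma sum_comps_balanced_K:
  "(\<Sum>d\<in>comps q (e 0 + s). balanced_K q (\<lambda>i. int (e (Suc i) + d i + Suc p + i))) =
    balanced_K (Suc q) ((\<lambda>i. int (e i + p + i))(0 := int (e 0 + s)))"
  by (subst balanced_K_peel[of _ "e 0 + s"]) (simp_all add: algebra_simps)

lemma lidskii_exponent:
  assumes "d \<in> comps q (e 0 + s)"
  shows "(\<Sum>i\<le>q. e (Suc i) + d i) + (\<Sum>i<q. Suc p + i) + Suc p + q =
      (\<Sum>i\<le>Suc q. e i) + (\<Sum>i<q. Suc p + i) + Suc p + q + s"
  using assms by (simp add: comps_def sum.distrib sum.atMost_Suc_shift del: sum.atMost_Suc)

lemma sum_shift_p: "(\<Sum>i<Suc q. p + i) = p + (\<Sum>i<q. Suc p + i)" for p q :: nat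
  by (subst sum.lessThan_Suc_shift) simp

text \<open>Each elimination keeps only the term \<open>s = p\<close>, whose coefficient is 1. The
  supply at 0 is then \<open>e 0 + p\<close>, so the sum over \<open>d\<close> reassembles into a
  single \<open>balanced_K\<close>.\<close>

lemma lidskii_sum_ge:
  "((T + p + q) choose ((\<Sum>i\<le>q. e i) + (\<Sum>i<q. p + i) + p + q)) *
    balanced_K q (\<lambda>i. int (e i + p + i)) \<le> lidskii_sum q p e T"
proof (induction q arbitrary: p e)
  case 0
  show ?case by (simp add: lidskii_sum_0 balanced_K_0)
next
  case (Suc q)
  let ?B = "(T + p + Suc q) choose ((\<Sum>i\<le>Suc q. e i) + (\<Sum>i<Suc q. p + i) + p + Suc q)"
  have "?B * balanced_K (Suc q) (\<lambda>i. int (e i + p + i)) =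
      (\<Sum>d\<in>comps q (e 0 + p). ?B * balanced_K q (\<lambda>i. int (e (Suc i) + d i + Suc p + i)))"
    unfolding sum_distrib_left[symmetric] sum_comps_balanced_K
    by (intro arg_cong2[of _ _ _ _ "(*)"] refl balanced_K_cong) auto
  also have "\<dots> \<le> (\<Sum>d\<in>comps q (e 0 + p). lidskii_sum q (Suc p) (\<lambda>i. e (Suc i) + d i) T)"
  proof (intro sum_mono)
    fix d assume d: "d \<in> comps q (e 0 + p)"
    have "(\<Sum>i\<le>Suc q. e i) + (\<Sum>i<Suc q. p + i) + p + Suc q =
        (\<Sum>i\<le>q. e (Suc i) + d i) + (\<Sum>i<q. Suc p + i) + Suc p + q"
      unfolding lidskii_exponent[of d q e p p, OF d] sum_shift_p by simp
    then show "?B * balanced_K q (\<lambda>i. int (e (Suc i) + d i + Suc p + i)) \<le>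
        lidskii_sum q (Suc p) (\<lambda>i. e (Suc i) + d i) T"
      using Suc.IH[of "Suc p" "\<lambda>i. e (Suc i) + d i"] by (simp only: add_Suc_right add_Suc)
  qed
  also have "\<dots> \<le> lidskii_sum (Suc q) p e T"
    unfolding lidskii_sum_Suc
    by (rule order_trans[OF _ member_le_sum[of p]]) auto
  finally show ?case .
qed

text \<open>For \<open>s \<le> p\<close> monotonicity replaces the supply \<open>e 0 + s\<close> by
  \<open>e 0 + p\<close>. The remaining sum over \<open>s\<close> collapses by
  \<open>vandermonde_shift\<close> and adds \<open>p\<close> to the upper entry, in total
  \<open>\<Sum>i<q. p + i\<close>.\<close>

lemma lidskii_sum_le:
  "lidskii_sum q p e T \<le>
    ((T + p + q + (\<Sum>i<q. p + i)) choose ((\<Sum>i\<le>q. e i) + (\<Sum>i<q. p + i) + p + q)) *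
    balanced_K q (\<lambda>i. int (e i + p + i))"
proof (induction q arbitrary: p e)
  case 0
  show ?case by (simp add: lidskii_sum_0 balanced_K_0)
next
  case (Suc q)
  \<comment> \<open>The binomial that the induction hypothesis yields for the term \<open>s\<close>
    is \<open>m choose (c + s)\<close>.\<close>
  define m where "m = T + Suc p + q + (\<Sum>i<q. Suc p + i)"
  define c where "c = (\<Sum>i\<le>Suc q. e i) + (\<Sum>i<q. Suc p + i) + Suc p + q"
  let ?N = "\<lambda>i. int (e i + p + i)"
  have "(\<Sum>d\<in>comps q (e 0 + s). lidskii_sum q (Suc p) (\<lambda>i. e (Suc i) + d i) T) \<le>
      (m choose (c + s)) * balanced_K (Suc q) ?N" if s: "s \<le> p" for s
  proof -
    have "(\<Sum>d\<in>comps q (e 0 + s). lidskii_sum q (Suc p) (\<lambda>i. e (Suc i) + d i) T) \<le>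
        (\<Sum>d\<in>comps q (e 0 + s). (m choose (c + s)) * balanced_K q (\<lambda>i. int (e (Suc i) + d i + Suc p + i)))"
    proof (intro sum_mono)
      fix d assume d: "d \<in> comps q (e 0 + s)"
      show "lidskii_sum q (Suc p) (\<lambda>i. e (Suc i) + d i) T \<le>
          (m choose (c + s)) * balanced_K q (\<lambda>i. int (e (Suc i) + d i + Suc p + i))"
        using Suc.IH[of "Suc p" "\<lambda>i. e (Suc i) + d i"]
        unfolding lidskii_exponent[of d q e s p, OF d] c_def m_def .
    qed
    also have "\<dots> = (m choose (c + s)) * balanced_K (Suc q) (?N(0 := int (e 0 + s)))"
      unfolding sum_distrib_left[symmetric] sum_comps_balanced_K ..
    also have "balanced_K (Suc q) (?N(0 := int (e 0 + s))) \<le> balanced_K (Suc q) (?N(0 := int (e 0 + p)))"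
      using s by (intro balanced_K_mono_0) auto
    also have "?N(0 := int (e 0 + p)) = ?N"
      by auto
    finally show ?thesis by simp
  qed
  then have "lidskii_sum (Suc q) p e T \<le>
      (\<Sum>s\<le>p. (p choose s) * ((m choose (c + s)) * balanced_K (Suc q) ?N))"
    unfolding lidskii_sum_Suc by (intro sum_mono mult_left_mono) auto
  also have "\<dots> = ((m + p) choose (c + p)) * balanced_K (Suc q) ?N"
    unfolding vandermonde_shift[symmetric] by (simp only: sum_distrib_right mult.assoc)
  also have "m + p = T + p + Suc q + (\<Sum>i<Suc q. p + i)"
    unfolding m_def sum_shift_p by simp
  also have "c + p = (\<Sum>i\<le>Suc q. e i) + (\<Sum>i<Suc q. p + i) + p + Suc q"
    unfolding c_def sum_shift_p by simp
  finally show ?case .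
qed

text \<open>Peeling the source gives the initial state; with \<open>p = 0\<close> and
  \<open>e = 0\<close> all binomial weights are 1.\<close>

lemma a_n_eq_lidskii_sum: "a_n (Suc q) (int T) = lidskii_sum q 0 (\<lambda>_. 0) T"
proof -
  have "a_n (Suc q) (int T) = (\<Sum>y\<in>comps q T. K q (\<lambda>i. tvec (Suc q) (int T) (Suc i) + int (y i)))"
    unfolding a_n_def by (rule K_peel) (simp add: tvec_def)
  also have "\<dots> = (\<Sum>y\<in>comps q T. balanced_K q (\<lambda>i. int (y i)))"
  proof (intro sum.cong refl)
    fix y assume "y \<in> comps q T"
    then have "(\<Sum>i\<le>q. int (y i)) = int T"
      by (auto simp: comps_def simp flip: of_nat_sum)
    then have "int (y q) - int T = - (\<Sum>i<q. int (y i))"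
      by (simp add: lessThan_Suc_atMost[symmetric])
    then show "K q (\<lambda>i. tvec (Suc q) (int T) (Suc i) + int (y i)) = balanced_K q (\<lambda>i. int (y i))"
      unfolding balanced_K_def balance_def by (intro K_cong) (auto simp: tvec_def)
  qed
  finally show ?thesis by (simp add: lidskii_sum_def)
qed

section \<open>Comparison of the binomial coefficients\<close>

text \<open>Raising the upper entry from \<open>A + i\<close> to \<open>B = A + i + 1\<close>
  multiplies the binomial by \<open>B / (B - D)\<close>, which the hypothesis bounds by
  \<open>(m + 1) / m\<close>.\<close>

lemma binomial_add_left_le:
  fixes A D m :: nat
  assumes "(m + 1) * D \<le> A"
  shows "(A + i choose D) * m ^ i \<le> (m + 1) ^ i * (A choose D)"
proof (induction i)
  case (Suc i)
  let ?B = "A + Suc i"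
  have D: "D < ?B"
    using assms le_trans[of D "(m + 1) * D" A] by simp
  have absorb: "(?B - D) * (?B choose D) = ?B * (A + i choose D)"
    using binomial_absorb_comp[of ?B D] by simp
  have "?B * m \<le> (m + 1) * (?B - D)"
    using assms D by (simp add: diff_mult_distrib2) (simp add: algebra_simps)
  then have "(?B * m) * ((A + i choose D) * m ^ i) \<le> ((m + 1) * (?B - D)) * ((m + 1) ^ i * (A choose D))"
    using Suc.IH by (rule mult_mono) auto
  moreover have "(?B * m) * ((A + i choose D) * m ^ i) = (?B - D) * ((?B choose D) * m ^ Suc i)"
    using absorb by (simp add: algebra_simps)
  moreover have "((m + 1) * (?B - D)) * ((m + 1) ^ i * (A choose D)) = (?B - D) * ((m + 1) ^ Suc i * (A choose D))"
    by (simp only: power_Suc mult_ac)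
  ultimately have "(?B - D) * ((?B choose D) * m ^ Suc i) \<le> (?B - D) * ((m + 1) ^ Suc i * (A choose D))"
    by (simp only:)
  then show ?case
    using D by (simp only: mult_le_cancel1 zero_less_diff simp_thms)
qed simp

lemma two_power_le_fact: "2 ^ q \<le> (fact (Suc q) :: real)"
proof (induction q)
  case (Suc q)
  have "2 * 2 ^ q \<le> real (Suc (Suc q)) * fact (Suc q)"
    using Suc.IH by (intro mult_mono) auto
  then show ?case by (simp only: power_Suc fact_Suc[of "Suc q"])
qed simp

text \<open>With \<open>M = q (q - 1) / 2\<close> and \<open>q > 0\<close>: \<open>(1 + 1/(q+1))^M
  \<le> exp (M/(q+1)) \<le> exp ((q-1)/2) \<le> 2^(q-1) \<le> q!\<close>.\<close>

lemma power_le_power_mult_fact: "(q + 2) ^ (\<Sum>i<q. i) \<le> (q + 1) ^ (\<Sum>i<q. i) * (fact q :: nat)"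
proof (cases q)
  case (Suc r)
  define M where "M = (\<Sum>i<q. i)"
  have "2 * M = q * r"
    unfolding M_def Suc by (induction r) auto
  then have "2 * real M = real q * real r"
    by (metis of_nat_mult of_nat_numeral)
  moreover have "real q * real r \<le> real r * real (q + 1)"
    by (simp add: algebra_simps)
  ultimately have M: "real M / real (q + 1) \<le> real r / 2"
    by (simp add: field_simps)
  have "(1 + 1 / real (q + 1)) ^ M \<le> exp (1 / real (q + 1)) ^ M"
    by (intro power_mono exp_ge_add_one_self) auto
  also have "\<dots> = exp (real M / real (q + 1))"
    by (simp flip: exp_of_nat_mult)
  also have "\<dots> \<le> exp (real r / 2)"
    using M by simp
  also have "\<dots> = exp (1 / 2) ^ r"
    by (simp flip: exp_of_nat_mult)
  also have "\<dots> \<le> 2 ^ r"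
    using exp_half_le2 by (intro power_mono) auto
  also have "\<dots> \<le> fact q"
    unfolding Suc by (rule two_power_le_fact)
  finally have "(1 + 1 / real (q + 1)) ^ M \<le> fact q" .
  moreover have "1 + 1 / real (q + 1) = real (q + 2) / real (q + 1)"
    by (simp add: field_simps)
  ultimately have "real (q + 2) ^ M \<le> fact q * real (q + 1) ^ M"
    by (simp add: power_divide divide_le_eq)
  then have "real ((q + 2) ^ M) \<le> real ((q + 1) ^ M * fact q)"
    by (simp add: mult.commute)
  then show ?thesis
    unfolding M_def of_nat_le_iff .
qed simp

lemma binomial_le_fact_mult_binomial:
  fixes q T :: nat
  assumes T: "(q + 1) ^ 3 \<le> 2 * T"
  shows "(T + q + (\<Sum>i<q. i)) choose (Suc q choose 2) \<le> fact q * ((T + q) choose (Suc q choose 2))"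
proof -
  define M where "M = (\<Sum>i<q. i)"
  define D where "D = Suc q choose 2"
  have "2 * D = Suc q * q"
    unfolding D_def by (simp add: choose_two)
  then have "2 * ((q + 2) * D) = (q + 2) * (Suc q * q)"
    by (metis mult.left_commute)
  also have "\<dots> \<le> (q + 1) ^ 3"
    by (simp add: power3_eq_cube algebra_simps)
  \<comment> \<open>This is where \<open>t \<ge> n^3 / 2\<close> enters, with
    \<open>m = q + 1\<close> in \<open>binomial_add_left_le\<close> and
    \<open>q (q + 2) \<le> (q + 1)^2\<close>.\<close>
  finally have "(q + 1 + 1) * D \<le> T + q"
    using T by simp
  then have "((T + q + M) choose D) * (q + 1) ^ M \<le> (q + 1 + 1) ^ M * ((T + q) choose D)"
    by (rule binomial_add_left_le)
  also have "\<dots> \<le> ((q + 1) ^ M * fact q) * ((T + q) choose D)"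
    using power_le_power_mult_fact[of q] by (intro mult_right_mono) (auto simp: M_def)
  finally have "(q + 1) ^ M * ((T + q + M) choose D) \<le> (q + 1) ^ M * (fact q * ((T + q) choose D))"
    by (simp only: mult_ac)
  moreover have "0 < (q + 1) ^ M" by simp
  ultimately show ?thesis
    unfolding M_def[symmetric] D_def[symmetric] using nat_mult_le_cancel1 by blast
qed

theorem theorem1p7:
  fixes n :: nat and t :: int
  assumes "n \<ge> 1" and "2 * t \<ge> int n ^ 3"
  shows "fact (n - 1) * (nat (t + int n - 1) choose (n choose 2)) * (\<Prod>i<n-1. catalan i)
           \<ge> a_n n t
       \<and> a_n n t \<ge> (nat (t + int n - 1) choose (n choose 2)) * (\<Prod>i<n-1. catalan i)"
proof -
  obtain q where n: "n = Suc q"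
    using assms(1) by (cases n) auto
  have "0 \<le> int n ^ 3" by simp
  then have "0 \<le> t" using assms(2) by linarith
  then obtain T where t: "t = int T"
    by (metis nonneg_int_cases)
  have "int ((q + 1) ^ 3) \<le> int (2 * T)"
    using assms(2) by (simp add: n t add.commute)
  then have T: "(q + 1) ^ 3 \<le> 2 * T"
    by (simp only: of_nat_le_iff)
  have exponent: "(\<Sum>i<q. i) + q = Suc q choose 2"
    by (induction q) (simp_all add: numeral_2_eq_2)
  have arg: "nat (t + int n - 1) = T + q"
    by (simp add: n t)
  \<comment> \<open>For \<open>p = 0\<close> and \<open>e = 0\<close> the supplies
    \<open>e i + p + i\<close> are the staircase \<open>0, ..., q - 1\<close>, whose
    \<open>balanced_K\<close> is the Catalan product.\<close>
  have lower: "((T + q) choose (Suc q choose 2)) * (\<Prod>i<q. catalan i) \<le> a_n n t"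
    using lidskii_sum_ge[of T 0 q "\<lambda>_. 0"]
    unfolding n t a_n_eq_lidskii_sum by (simp add: exponent balanced_K_stair)
  have "a_n n t \<le> ((T + q + (\<Sum>i<q. i)) choose (Suc q choose 2)) * (\<Prod>i<q. catalan i)"
    using lidskii_sum_le[of q 0 "\<lambda>_. 0" T]
    unfolding n t a_n_eq_lidskii_sum by (simp add: exponent balanced_K_stair)
  also have "\<dots> \<le> fact q * ((T + q) choose (Suc q choose 2)) * (\<Prod>i<q. catalan i)"
    by (intro mult_right_mono binomial_le_fact_mult_binomial T) simp
  finally show ?thesis
    using lower unfolding arg by (simp add: n)
qed

end
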